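(* Let $\mathcal H_1,\mathcal H_2,\mathcal G$ be real Hilbert spaces, $A:\mathcal H_1\to\mathcal G$ and $B:\mathcal H_2\to\mathcal G$ continuous linear maps, $b\in\mathcal G$, $f$ and $g$ proper closed convex extended-real-valued functions on $\mathcal H_1$ and $\mathcal H_2$, and let $F,G$ and Algorithms 1, 2, 3 be as in the context, under the standing assumptions stated there. Suppose $Ax_1^0=s_2^0=z_3^0$ and $z_1^0=z_2^0=u_3^0$ and that the same parameter $\lambda>0$ is used in the three algorithms. Then: 1. (Algorithms 1 and 2.) (a) If $(x_1^k,y_1^k,z_1^k)$ are iterates of Algorithm 1, then the iterates of Algorithm 2 are given by $$t_2^k=By_1^k-b,\qquad s_2^k=Ax_1^k,\qquad z_2^k=z_1^k\qquad (k\ge 1).$$ (b) Conversely, if $(t_2^k,s_2^k,z_2^k)$ are the iterates of Algorithm 2, then iterates of Algorithm 1 are obtained through $$y_1^k\in\operatorname*{arg\,min}_y\{g(y): By-b=t_2^k\},\qquad x_1^k\in\operatorname*{arg\,min}_x\{f(x): Ax=s_2^k\},\qquad z_1^k=z_2^k\qquad(k\ge1).$$ 2. (Algorithms 2 and 3.) The iterates of Algorithms 2 and 3 can be recovered from each other through $$u_3^k=z_2^k,\qquad z_3^k=s_2^k\qquad\text{for all }k\ge 0.$$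
   Context: $A^*$ denotes the adjoint of $A$, and $h^*(v)=\sup_x\{\langle v,x\rangle-h(x)\}$ the convex conjugate of $h$. Define on $\mathcal G$ $$F(s)=\min_x\{f(x):Ax=s\},\qquad G(t)=\min_y\{g(y):By-b=t\}$$ (with value $+\infty$ if there is no feasible point with finite objective). Standing assumptions: all functions, including $F$ and $G$, are proper, closed and convex; the minima defining $F$ and $G$ are attained wherever they are finite; saddle-point solutions of the optimization problems involved exist. One has $F^*(u)=f^*(A^*u)$ and $G^*(v)=g^*(B^*v)-\langle v,b\rangle$. The three problems are: (P1) minimize $f(x)+g(y)$ subject to $Ax+By=b$; (P2) minimize $F(s)+G(t)$ subject to $s+t=0$; (D) minimize $F^*(-u)+G^*(-v)=f^*(-A^*u)+g^*(-B^*v)+\langle v,b\rangle$ subject to $u-v=0$ (the Lagrange dual in split form). Algorithm 1 (ADM on (P1)): given $x_1^0,z_1^0$ and $\lambda>0$, for $k=0,1,\dots$: $y_1^{k+1}\in\arg\min_y g(y)+\frac1{2\lambda}\|Ax_1^k+By-b+\lambda z_1^k\|^2$; $x_1^{k+1}\in\arg\min_x f(x)+\frac1{2\lambda}\|Ax+By_1^{k+1}-b+\lambda z_1^k\|^2$; $z_1^{k+1}=z_1^k+\lambda^{-1}(Ax_1^{k+1}+By_1^{k+1}-b)$. (Minimizers need not be unique; any may be chosen.) Algorithm 2 (ADM on (P2)): given $s_2^0,z_2^0$ and $\lambda>0$, for $k=0,1,\dots$: $t_2^{k+1}=\arg\min_t G(t)+\frac1{2\lambda}\|s_2^k+t+\lambda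 z_2^k\|^2$; $s_2^{k+1}=\arg\min_s F(s)+\frac1{2\lambda}\|s+t_2^{k+1}+\lambda z_2^k\|^2$; $z_2^{k+1}=z_2^k+\lambda^{-1}(s_2^{k+1}+t_2^{k+1})$. Algorithm 3 (ADM on (D)): given $u_3^0,z_3^0$ and $\lambda>0$, for $k=0,1,\dots$: $v_3^{k+1}=\arg\min_v G^*(-v)+\frac\lambda2\|u_3^k-v+\lambda^{-1}z_3^k\|^2$; $u_3^{k+1}=\arg\min_u F^*(-u)+\frac\lambda2\|u-v_3^{k+1}+\lambda^{-1}z_3^k\|^2$; $z_3^{k+1}=z_3^k+\lambda(u_3^{k+1}-v_3^{k+1})$. *)

theory Defs
  imports "HOL-Analysis.Analysis"
begin

text \<open>
  Real Hilbert spaces are types of sort \<open>{real_inner, complete_space}\<close>.  Extended-real-valued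
  functions take values in \<open>ereal\<close>.  The expressions \<open>\<infinity> - \<infinity>\<close> that \<open>ereal\<close> resolves by convention
  do not arise below, since all functions involved are assumed to be proper (and conjugates of
  proper closed convex functions are again proper).
\<close>

definition proper_fun :: "('a \<Rightarrow> ereal) \<Rightarrow> bool" where
  "proper_fun h \<longleftrightarrow> (\<forall>x. h x \<noteq> -\<infinity>) \<and> (\<exists>x. h x \<noteq> \<infinity>)"

text \<open>The library constant \<open>epigraph\<close> only covers real-valued functions.\<close>

definition epi :: "('a \<Rightarrow> ereal) \<Rightarrow> ('a \<times> real) set" where
  "epi h = {(x, r). h x \<le> ereal r}"

definition proper_closed_convex :: "('a::real_normed_vector \<Rightarrow> ereal) \<Rightarrow> bool" where
  "proper_closed_convex h \<longleftrightarrow> proper_fun h \<and> closed (epi h) \<and> convex (epi h)"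

definition conjugate :: "('a::real_inner \<Rightarrow> ereal) \<Rightarrow> 'a \<Rightarrow> ereal" where
  "conjugate h v = (SUP x. ereal (inner v x) - h x)"

text \<open>
  \<open>value_fun M h s\<close> is \<open>min {h x | M x = s}\<close>, as an infimum; it is \<open>\<infinity>\<close> if there is no feasible point
  with finite objective.  Here \<open>M\<close> is \<open>A\<close> or the affine map \<open>\<lambda>y. B y - b\<close>.
\<close>

definition value_fun :: "('a \<Rightarrow> 'g) \<Rightarrow> ('a \<Rightarrow> ereal) \<Rightarrow> 'g \<Rightarrow> ereal" where
  "value_fun M h s = (INF x\<in>{x. M x = s}. h x)"

definition value_attained :: "('a \<Rightarrow> 'g) \<Rightarrow> ('a \<Rightarrow> ereal) \<Rightarrow> bool" where
  "value_attained M h \<longleftrightarrow>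
     (\<forall>s. \<bar>value_fun M h s\<bar> \<noteq> \<infinity> \<longrightarrow> (\<exists>x. M x = s \<and> h x = value_fun M h s))"

definition arg_min_set :: "('a \<Rightarrow> ereal) \<Rightarrow> 'a set \<Rightarrow> 'a set" where
  "arg_min_set h S = {x. is_arg_min h (\<lambda>x. x \<in> S) x}"

definition saddle_point :: "('p \<Rightarrow> 'z \<Rightarrow> ereal) \<Rightarrow> 'p \<Rightarrow> 'z \<Rightarrow> bool" where
  "saddle_point L p z \<longleftrightarrow> (\<forall>p' z'. L p z' \<le> L p z \<and> L p z \<le> L p' z)"

definition lagrangian_P1 ::
  "('a \<Rightarrow> ereal) \<Rightarrow> ('b \<Rightarrow> ereal) \<Rightarrow> ('a \<Rightarrow> 'g) \<Rightarrow> ('b \<Rightarrow> 'g) \<Rightarrow> 'g::real_inner \<Rightarrow>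
   'a \<times> 'b \<Rightarrow> 'g \<Rightarrow> ereal" where
  "lagrangian_P1 f g A B b = (\<lambda>(x, y) z. f x + g y + ereal (inner z (A x + B y - b)))"

definition lagrangian_P2 ::
  "('g \<Rightarrow> ereal) \<Rightarrow> ('g \<Rightarrow> ereal) \<Rightarrow> 'g::real_inner \<times> 'g \<Rightarrow> 'g \<Rightarrow> ereal" where
  "lagrangian_P2 F G = (\<lambda>(s, t) z. F s + G t + ereal (inner z (s + t)))"

definition lagrangian_D ::
  "('g \<Rightarrow> ereal) \<Rightarrow> ('g \<Rightarrow> ereal) \<Rightarrow> 'g::real_inner \<times> 'g \<Rightarrow> 'g \<Rightarrow> ereal" where
  "lagrangian_D F G =
     (\<lambda>(u, v) z. conjugate F (- u) + conjugate G (- v) + ereal (inner z (u - v)))"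

text \<open>
  In the three algorithms the \<open>0\<close>-th entries of the sequences \<open>y\<close>, \<open>t\<close>, \<open>v\<close> are not part of the data
  and are left unconstrained.  \<open>adm_P1\<close> allows any choice of minimizers; in \<open>adm_P2\<close> and \<open>adm_D\<close>
  each argmin is a single point, hence the equations with singletons.
\<close>

definition adm_P1 ::
  "('a \<Rightarrow> ereal) \<Rightarrow> ('b \<Rightarrow> ereal) \<Rightarrow> ('a \<Rightarrow> 'g) \<Rightarrow> ('b \<Rightarrow> 'g) \<Rightarrow> 'g::real_inner \<Rightarrow> real \<Rightarrow> 'a \<Rightarrow> 'g \<Rightarrow>
   (nat \<Rightarrow> 'a) \<Rightarrow> (nat \<Rightarrow> 'b) \<Rightarrow> (nat \<Rightarrow> 'g) \<Rightarrow> bool" where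
  "adm_P1 f g A B b lam x0 z0 x y z \<longleftrightarrow>
     x 0 = x0 \<and> z 0 = z0 \<and>
     (\<forall>k.
       y (Suc k) \<in> arg_min_set
         (\<lambda>\<eta>. g \<eta> + ereal (1 / (2 * lam) * (norm (A (x k) + B \<eta> - b + lam *\<^sub>R z k))\<^sup>2)) UNIV \<and>
       x (Suc k) \<in> arg_min_set
         (\<lambda>\<xi>. f \<xi> + ereal (1 / (2 * lam) * (norm (A \<xi> + B (y (Suc k)) - b + lam *\<^sub>R z k))\<^sup>2)) UNIV \<and>
       z (Suc k) = z k + (1 / lam) *\<^sub>R (A (x (Suc k)) + B (y (Suc k)) - b))"

definition adm_P2 ::
  "('g \<Rightarrow> ereal) \<Rightarrow> ('g \<Rightarrow> ereal) \<Rightarrow> real \<Rightarrow> 'g::real_inner \<Rightarrow> 'g \<Rightarrow>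
   (nat \<Rightarrow> 'g) \<Rightarrow> (nat \<Rightarrow> 'g) \<Rightarrow> (nat \<Rightarrow> 'g) \<Rightarrow> bool" where
  "adm_P2 F G lam s0 z0 s t z \<longleftrightarrow>
     s 0 = s0 \<and> z 0 = z0 \<and>
     (\<forall>k.
       arg_min_set
         (\<lambda>\<tau>. G \<tau> + ereal (1 / (2 * lam) * (norm (s k + \<tau> + lam *\<^sub>R z k))\<^sup>2)) UNIV = {t (Suc k)} \<and>
       arg_min_set
         (\<lambda>\<sigma>. F \<sigma> + ereal (1 / (2 * lam) * (norm (\<sigma> + t (Suc k) + lam *\<^sub>R z k))\<^sup>2)) UNIV = {s (Suc k)} \<and>
       z (Suc k) = z k + (1 / lam) *\<^sub>R (s (Suc k) + t (Suc k)))"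

definition adm_D ::
  "('g \<Rightarrow> ereal) \<Rightarrow> ('g \<Rightarrow> ereal) \<Rightarrow> real \<Rightarrow> 'g::real_inner \<Rightarrow> 'g \<Rightarrow>
   (nat \<Rightarrow> 'g) \<Rightarrow> (nat \<Rightarrow> 'g) \<Rightarrow> (nat \<Rightarrow> 'g) \<Rightarrow> bool" where
  "adm_D F G lam u0 z0 u v z \<longleftrightarrow>
     u 0 = u0 \<and> z 0 = z0 \<and>
     (\<forall>k.
       arg_min_set
         (\<lambda>\<nu>. conjugate G (- \<nu>) + ereal (lam / 2 * (norm (u k - \<nu> + (1 / lam) *\<^sub>R z k))\<^sup>2)) UNIV
         = {v (Suc k)} \<and>
       arg_min_set
         (\<lambda>\<mu>. conjugate F (- \<mu>) + ereal (lam / 2 * (norm (\<mu> - v (Suc k) + (1 / lam) *\<^sub>R z k))\<^sup>2)) UNIV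
         = {u (Suc k)} \<and>
       z (Suc k) = z k + lam *\<^sub>R (u (Suc k) - v (Suc k)))"

end

theory Submission
  imports Defs
begin

text \<open>
  Minimizing a function of \<open>M x\<close> plus \<open>h x\<close> over \<open>x\<close> can be done fibre by fibre, which turns each
  step of ADM on (P1) into a proximal step for \<open>F\<close> or \<open>G\<close>, that is, into a step of ADM on (P2).
  By Moreau's decomposition the proximal points of \<open>h\<close> and \<open>h\<^sup>*\<close> with the same shift \<open>w\<close> determine
  each other: \<open>p\<close> corresponds to \<open>(p + w) / lam\<close>, and under this correspondence the steps of ADM on
  (P2) and on (D) agree.  The direction from (D) to (P2) needs existence of proximal points; the
  affine minorants for that come from the saddle point of (P2) rather than from Hahn-Banach.
\<close>

subsection \<open>Minimizers\<close>

lemma arg_min_set_iff: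
  "x \<in> arg_min_set h S \<longleftrightarrow> x \<in> S \<and> (\<forall>y\<in>S. h x \<le> h y)"
  by (auto simp: arg_min_set_def is_arg_min_def not_less)

text \<open>One growth estimate yields both minimality and uniqueness. It serves the primal proximal
  problem with \<open>e = 1 / (2 * lam)\<close> and the dual one with
  \<open>e = lam / 2\<close>.\<close>

lemma arg_min_set_quadratic_growth:
  fixes \<phi> :: "'a::real_normed_vector \<Rightarrow> ereal"
  assumes "\<phi> p = ereal m" and "e > 0"
    and growth: "\<And>x. ereal (m + e * (norm (x - p))\<^sup>2) \<le> \<phi> x"
  shows "arg_min_set \<phi> UNIV = {p}"
proof -
  have "\<phi> p \<le> \<phi> x" for x
    using order_trans[OF _ growth[of x], of "ereal m"] assms(1,2) by simp
  moreover have "x = p" if "\<phi> x \<le> \<phi> p" for x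
  proof -
    have "ereal (m + e * (norm (x - p))\<^sup>2) \<le> ereal m"
      using order_trans[OF growth that] assms(1) by simp
    then have "e * (norm (x - p))\<^sup>2 \<le> 0"
      by simp
    then show ?thesis
      using \<open>e > 0\<close> by (simp add: mult_le_0_iff)
  qed
  ultimately show ?thesis
    by (auto simp: arg_min_set_iff)
qed

lemma arg_min_set_inf:
  assumes "x \<in> arg_min_set h S"
  shows "(INF y\<in>S. h y) = h x"
  using assms by (auto simp: arg_min_set_iff intro!: antisym INF_lower INF_greatest)

subsection \<open>Proximal points of closed convex functions\<close>

lemma convex_epiD:
  assumes "convex (epi h)" "h x \<le> ereal r" "h y \<le> ereal r'" "0 \<le> u" "u \<le> 1"
  shows "h ((1 - u) *\<^sub>R x + u *\<^sub>R y) \<le> ereal ((1 - u) * r + u * r')"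
proof -
  have "(1 - u) *\<^sub>R (x, r) + u *\<^sub>R (y, r') \<in> epi h"
    using assms by (intro convexD) (auto simp: epi_def)
  then show ?thesis
    by (simp add: epi_def)
qed

lemma closed_epiD:
  assumes "closed (epi h)" "\<And>n. h (x n) \<le> ereal (r n)" "x \<longlonglongrightarrow> a" "r \<longlonglongrightarrow> c"
  shows "h a \<le> ereal c"
proof -
  have "(a, c) \<in> epi h"
  proof (rule closed_sequentially[OF assms(1)])
    show "(x n, r n) \<in> epi h" for n
      using assms(2) by (simp add: epi_def)
    show "(\<lambda>n. (x n, r n)) \<longlonglongrightarrow> (a, c)"
      using assms(3,4) by (rule tendsto_Pair)
  qed
  then show ?thesis
    by (simp add: epi_def)
qed

lemma arg_min_set_add_real:
  assumes "proper_fun h" "p \<in> arg_min_set (\<lambda>x. h x + ereal (q x)) UNIV"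
  obtains c where "h p = ereal c"
proof -
  obtain x where "h x \<noteq> \<infinity>"
    using assms(1) by (auto simp: proper_fun_def)
  then have "h p \<noteq> \<infinity>"
    using assms(2) by (auto simp: arg_min_set_iff dest: spec[of _ x])
  moreover have "h p \<noteq> -\<infinity>"
    using assms(1) by (auto simp: proper_fun_def)
  ultimately show ?thesis
    using that by (cases "h p") auto
qed

text \<open>Fermat's rule: \<open>- (p + w) / lam\<close> is a subgradient of \<open>h\<close> at
  \<open>p\<close>. It follows by comparing \<open>p\<close> with the points of the segment from
  \<open>p\<close> to \<open>y\<close> and letting them tend to \<open>p\<close>.\<close>

lemma prox_subgradient:
  fixes h :: "'a::real_inner \<Rightarrow> ereal"
  assumes h: "proper_closed_convex h" and lam: "lam > 0"
    and p: "p \<in> arg_min_set (\<lambda>x. h x + ereal (1 / (2 * lam) * (norm (x + w))\<^sup>2)) UNIV"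
    and c: "h p = ereal c"
  shows "ereal (c - inner (p + w) (y - p) / lam) \<le> h y"
proof (cases "h y")
  case (real d)
  have cv: "convex (epi h)"
    using h by (simp add: proper_closed_convex_def)
  \<comment> \<open>After convexity bounds \<open>h ?y\<close> and the square is expanded, every
    remaining term carries a factor \<open>u\<close>, which is divided out. Only the quadratic term
    keeps a second factor \<open>u\<close>, so it vanishes in the limit from the right
    below.\<close>
  have ineq: "0 \<le> (d - c) + inner (p + w) (y - p) / lam + u * ((norm (y - p))\<^sup>2 / (2 * lam))"
    if u: "0 < u" "u \<le> 1" for u
  proof -
    let ?y = "(1 - u) *\<^sub>R p + u *\<^sub>R y"
    have yw: "?y + w = (p + w) + u *\<^sub>R (y - p)"
      by (simp add: algebra_simps)
    have "h p + ereal (1 / (2 * lam) * (norm (p + w))\<^sup>2)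
        \<le> h ?y + ereal (1 / (2 * lam) * (norm (?y + w))\<^sup>2)"
      using p by (auto simp: arg_min_set_iff)
    also have "\<dots> \<le> ereal ((1 - u) * c + u * d) + ereal (1 / (2 * lam) * (norm (?y + w))\<^sup>2)"
      using u c real by (intro add_right_mono convex_epiD[OF cv]) auto
    finally have "c + 1 / (2 * lam) * (norm (p + w))\<^sup>2
        \<le> (1 - u) * c + u * d + 1 / (2 * lam) * (norm (?y + w))\<^sup>2"
      by (simp add: c)
    also have "(norm (?y + w))\<^sup>2
        = (norm (p + w))\<^sup>2 + 2 * u * inner (p + w) (y - p) + u\<^sup>2 * (norm (y - p))\<^sup>2"
      unfolding yw power2_norm_eq_inner
      by (simp add: inner_add_left inner_add_right inner_commute power2_eq_square)
    also have "1 / (2 * lam) * \<dots> = 1 / (2 * lam) * (norm (p + w))\<^sup>2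
        + u * (inner (p + w) (y - p) / lam + u * ((norm (y - p))\<^sup>2 / (2 * lam)))"
      using lam by (simp add: field_simps power2_eq_square)
    finally have "0 \<le> u * ((d - c) + inner (p + w) (y - p) / lam
        + u * ((norm (y - p))\<^sup>2 / (2 * lam)))"
      by (simp add: algebra_simps)
    then show ?thesis
      using u by (simp add: zero_le_mult_iff)
  qed
  have "((\<lambda>u. (d - c) + inner (p + w) (y - p) / lam + u * ((norm (y - p))\<^sup>2 / (2 * lam)))
      \<longlongrightarrow> (d - c) + inner (p + w) (y - p) / lam + 0 * ((norm (y - p))\<^sup>2 / (2 * lam))) (at_right 0)"
    by (intro tendsto_intros)
  then have "0 \<le> (d - c) + inner (p + w) (y - p) / lam + 0 * ((norm (y - p))\<^sup>2 / (2 * lam))"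
  proof (rule tendsto_lowerbound)
    show "\<forall>\<^sub>F u in at_right 0.
        0 \<le> (d - c) + inner (p + w) (y - p) / lam + u * ((norm (y - p))\<^sup>2 / (2 * lam))"
      by (rule eventually_at_rightI[of 0 1]) (use ineq in auto)
  qed simp
  then show ?thesis
    by (simp add: real)
next
  case MInf
  then show ?thesis
    using h by (auto simp: proper_closed_convex_def proper_fun_def)
qed auto

text \<open>Expanding the square around \<open>p\<close> produces the linear term
  \<open>inner (p + w) (y - p) / lam\<close>, which the subgradient inequality for \<open>h\<close>
  cancels. What is left is growth by \<open>1 / (2 * lam) * (norm (y - p))\<^sup>2\<close>.\<close>

lemma prox_unique:
  fixes h :: "'a::real_inner \<Rightarrow> ereal"
  assumes h: "proper_closed_convex h" and lam: "lam > 0"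
    and p: "p \<in> arg_min_set (\<lambda>x. h x + ereal (1 / (2 * lam) * (norm (x + w))\<^sup>2)) UNIV"
  shows "arg_min_set (\<lambda>x. h x + ereal (1 / (2 * lam) * (norm (x + w))\<^sup>2)) UNIV = {p}"
proof -
  obtain c where c: "h p = ereal c"
    using arg_min_set_add_real[OF _ p] h by (auto simp: proper_closed_convex_def)
  show ?thesis
  proof (rule arg_min_set_quadratic_growth)
    show "h p + ereal (1 / (2 * lam) * (norm (p + w))\<^sup>2)
        = ereal (c + 1 / (2 * lam) * (norm (p + w))\<^sup>2)"
      by (simp add: c)
    show "1 / (2 * lam) > 0"
      using lam by simp
    fix y
    have "(norm (y + w))\<^sup>2 = (norm (p + w))\<^sup>2 + 2 * inner (p + w) (y - p) + (norm (y - p))\<^sup>2"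
      unfolding power2_norm_eq_inner
      by (simp add: inner_add_left inner_add_right inner_diff_left inner_diff_right inner_commute)
    then have "c + 1 / (2 * lam) * (norm (p + w))\<^sup>2 + 1 / (2 * lam) * (norm (y - p))\<^sup>2
        = (c - inner (p + w) (y - p) / lam) + 1 / (2 * lam) * (norm (y + w))\<^sup>2"
      using lam by (simp add: field_simps)
    then show "ereal (c + 1 / (2 * lam) * (norm (p + w))\<^sup>2 + 1 / (2 * lam) * (norm (y - p))\<^sup>2)
        \<le> h y + ereal (1 / (2 * lam) * (norm (y + w))\<^sup>2)"
      using add_right_mono[OF prox_subgradient[OF h lam p c, of y]]
      by (metis plus_ereal.simps(1))
  qed
qed

text \<open>
  The parallelogram law makes a minimizing sequence Cauchy; this is what replaces weak
  compactness in the existence proof.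
\<close>

lemma prox_exists:
  fixes h :: "'a::{real_inner, complete_space} \<Rightarrow> ereal"
  assumes h: "proper_closed_convex h" and lam: "lam > 0"
    and minorant: "\<And>x. ereal (\<beta> + inner a x) \<le> h x"
  shows "\<exists>p. p \<in> arg_min_set (\<lambda>x. h x + ereal (1 / (2 * lam) * (norm (x + w))\<^sup>2)) UNIV"
proof -
  let ?q = "\<lambda>x. 1 / (2 * lam) * (norm (x + w))\<^sup>2"
  \<comment> \<open>On the effective domain \<open>D\<close> the objective is real-valued, so that
    its infimum can be taken in the reals.\<close>
  define D where "D = {x. h x \<noteq> \<infinity>}"
  define \<phi> where "\<phi> x = real_of_ereal (h x) + ?q x" for x
  have cv: "convex (epi h)" and cl: "closed (epi h)" and pr: "proper_fun h"
    using h by (auto simp: proper_closed_convex_def)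
  have fin: "h x = ereal (real_of_ereal (h x))" if "x \<in> D" for x
    using that pr by (cases "h x") (auto simp: D_def proper_fun_def)
  have "D \<noteq> {}"
    using pr by (auto simp: D_def proper_fun_def)
  \<comment> \<open>Completing the square: the minorant's slope \<open>a\<close> is absorbed into
    the quadratic term by shifting its argument by \<open>lam *\<^sub>R a\<close>, which leaves this
    constant as a lower bound.\<close>
  have "\<beta> - inner a w - lam / 2 * (norm a)\<^sup>2 \<le> \<phi> x" if "x \<in> D" for x
  proof -
    have "\<beta> + inner a x \<le> real_of_ereal (h x)"
      using minorant[of x] fin[OF that] by (metis ereal_less_eq(3))
    moreover have "0 \<le> 1 / (2 * lam) * (norm (x + w + lam *\<^sub>R a))\<^sup>2"
      using lam by simp
    moreover have "1 / (2 * lam) * (norm (x + w + lam *\<^sub>R a))\<^sup>2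
        = ?q x + inner a x + inner a w + lam / 2 * (norm a)\<^sup>2"
      unfolding power2_norm_eq_inner using lam
      by (simp add: inner_add_left inner_add_right inner_commute field_simps power2_eq_square)
    ultimately show ?thesis
      by (simp add: \<phi>_def)
  qed
  then have bdd: "bdd_below (\<phi> ` D)"
    by (rule bdd_belowI2)
  define m where "m = (INF x\<in>D. \<phi> x)"
  have m_le: "m \<le> \<phi> x" if "x \<in> D" for x
    unfolding m_def using bdd that by (rule cINF_lower)
  have "\<exists>x\<in>D. \<phi> x < m + 1 / Suc n" for n
    using cINF_less_iff[OF \<open>D \<noteq> {}\<close> bdd, of "m + 1 / Suc n"] by (simp add: m_def)
  then obtain X where X: "\<And>n. X n \<in> D" and Xm: "\<And>n. \<phi> (X n) < m + 1 / Suc n"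
    by metis
  \<comment> \<open>The infimum \<open>m\<close> bounds \<open>\<phi>\<close> at the midpoint from
    below, convexity bounds \<open>h\<close> there from above, and the parallelogram law leaves
    \<open>1 / (8 * lam) * (norm (x - y))\<^sup>2\<close> over. Hence near-minimizers are close
    together. The coefficient \<open>1 - 1/2\<close> matches \<open>convex_epiD\<close> with
    \<open>u = 1/2\<close>.\<close>
  have par: "(norm (x - y))\<^sup>2 \<le> 4 * lam * ((\<phi> x - m) + (\<phi> y - m))" if "x \<in> D" "y \<in> D" for x y
  proof -
    let ?z = "(1 - 1/2) *\<^sub>R x + (1/2) *\<^sub>R y"
    have le: "h ?z \<le> ereal ((1 - 1/2) * real_of_ereal (h x) + 1/2 * real_of_ereal (h y))"
      using fin that by (intro convex_epiD[OF cv]) auto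
    then have "?z \<in> D"
      by (auto simp: D_def)
    have "real_of_ereal (h ?z) \<le> (1 - 1/2) * real_of_ereal (h x) + 1/2 * real_of_ereal (h y)"
      using le fin[OF \<open>?z \<in> D\<close>] by (metis ereal_less_eq(3))
    then have "m \<le> 1/2 * real_of_ereal (h x) + 1/2 * real_of_ereal (h y) + ?q ?z"
      using m_le[OF \<open>?z \<in> D\<close>] by (simp add: \<phi>_def)
    moreover have "?q ?z = 1/2 * ?q x + 1/2 * ?q y - 1 / (8 * lam) * (norm (x - y))\<^sup>2"
    proof -
      have "?z + w = (1/2) *\<^sub>R ((x + w) + (y + w))"
        by (simp add: algebra_simps flip: scaleR_2)
      then have "(norm (?z + w))\<^sup>2 = 1/4 * (norm ((x + w) + (y + w)))\<^sup>2"
        by (simp add: power_divide)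
      also have "\<dots> = 1/2 * (norm (x + w))\<^sup>2 + 1/2 * (norm (y + w))\<^sup>2 - 1/4 * (norm (x - y))\<^sup>2"
        unfolding power2_norm_eq_inner
        by (simp add: inner_add_left inner_add_right inner_diff_left inner_diff_right inner_commute
            algebra_simps)
      finally have "?q ?z = 1 / (2 * lam) * (1/2 * (norm (x + w))\<^sup>2 + 1/2 * (norm (y + w))\<^sup>2
          - 1/4 * (norm (x - y))\<^sup>2)"
        by (simp only:)
      then show ?thesis
        by (simp add: right_diff_distrib distrib_left mult.commute)
    qed
    ultimately have "1 / (8 * lam) * (norm (x - y))\<^sup>2 \<le> 1/2 * ((\<phi> x - m) + (\<phi> y - m))"
      by (simp add: \<phi>_def)
    then show ?thesis
      using lam by (simp add: field_simps)
  qed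
  have inv_lim: "(\<lambda>n. 1 / real (Suc n)) \<longlonglongrightarrow> 0"
    by (rule LIMSEQ_Suc) (rule lim_1_over_n)
  have "Cauchy X"
  proof (rule metric_CauchyI)
    fix e :: real assume "e > 0"
    \<comment> \<open>Two gaps below this threshold, multiplied by the factor \<open>4 * lam\<close>
      of \<open>par\<close>, add up to less than \<open>e\<^sup>2\<close>.\<close>
    then have "0 < e\<^sup>2 / (8 * lam)"
      using lam by simp
    then have "\<forall>\<^sub>F n in sequentially. 1 / real (Suc n) < e\<^sup>2 / (8 * lam)"
      using inv_lim by (intro order_tendstoD)
    then obtain N where N: "\<And>n. n \<ge> N \<Longrightarrow> 1 / real (Suc n) < e\<^sup>2 / (8 * lam)"
      by (auto simp: eventually_sequentially)
    have "dist (X i) (X j) < e" if "i \<ge> N" "j \<ge> N" for i j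
    proof -
      have "(norm (X i - X j))\<^sup>2 \<le> 4 * lam * ((\<phi> (X i) - m) + (\<phi> (X j) - m))"
        using par X by blast
      also have "\<dots> < 4 * lam * (e\<^sup>2 / (8 * lam) + e\<^sup>2 / (8 * lam))"
        using Xm[of i] Xm[of j] N[of i] N[of j] that lam
        by (intro mult_strict_left_mono) auto
      also have "\<dots> = e\<^sup>2"
        using lam by (simp add: field_simps)
      finally show ?thesis
        using \<open>e > 0\<close> by (simp add: dist_norm power_less_imp_less_base)
    qed
    then show "\<exists>M. \<forall>i\<ge>M. \<forall>j\<ge>M. dist (X i) (X j) < e"
      by blast
  qed
  then obtain p where p: "X \<longlonglongrightarrow> p"
    using Cauchy_convergent_iff convergent_def by blast
  \<comment> \<open>Closedness of the epigraph acts as lower semicontinuity: these heights dominate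
    \<open>h (X n)\<close> and converge, because the quadratic term is continuous.\<close>
  have "(\<lambda>n. m + 1 / real (Suc n) - ?q (X n)) \<longlonglongrightarrow> m + 0 - ?q p"
    using p inv_lim by (intro tendsto_intros)
  moreover have "h (X n) \<le> ereal (m + 1 / real (Suc n) - ?q (X n))" for n
    using Xm[of n] fin[OF X[of n]] by (metis \<phi>_def ereal_less_eq(3) le_diff_eq less_imp_le)
  ultimately have "h p \<le> ereal (m + 0 - ?q p)"
    by (intro closed_epiD[OF cl _ p])
  then have hp: "h p \<le> ereal (m - ?q p)"
    by simp
  have "h p + ereal (?q p) \<le> h x + ereal (?q x)" for x
  proof (cases "x \<in> D")
    case True
    have "h p + ereal (?q p) \<le> ereal m"
      using add_right_mono[OF hp, of "ereal (?q p)"] by simp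
    also have "\<dots> \<le> ereal (\<phi> x)"
      using m_le[OF True] by simp
    also have "\<dots> = h x + ereal (?q x)"
      using fin[OF True] by (metis \<phi>_def plus_ereal.simps(1))
    finally show ?thesis .
  qed (auto simp: D_def)
  then show ?thesis
    by (auto simp: arg_min_set_iff)
qed

subsection \<open>Moreau decomposition\<close>

text \<open>With \<open>\<nu>\<^sub>0 = (p + w) / lam\<close>, the subgradient inequality gives
  equality in Fenchel-Young for the pair \<open>p\<close>, \<open>- \<nu>\<^sub>0\<close>. For every
  other \<open>\<nu>\<close>, Fenchel-Young bounds the conjugate below by a function affine in
  \<open>\<nu>\<close>. Its slope \<open>- p\<close> cancels the gradient of the quadratic term at
  \<open>\<nu>\<^sub>0\<close>, and quadratic growth remains.\<close>

lemma prox_conjugate: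
  fixes h :: "'a::real_inner \<Rightarrow> ereal"
  assumes h: "proper_closed_convex h" and lam: "lam > 0"
    and p: "p \<in> arg_min_set (\<lambda>x. h x + ereal (1 / (2 * lam) * (norm (x + w))\<^sup>2)) UNIV"
  shows "arg_min_set (\<lambda>\<nu>. conjugate h (- \<nu>) + ereal (lam / 2 * (norm (\<nu> - (1 / lam) *\<^sub>R w))\<^sup>2)) UNIV
    = {(1 / lam) *\<^sub>R (p + w)}"
proof -
  obtain c where c: "h p = ereal c"
    using arg_min_set_add_real[OF _ p] h by (auto simp: proper_closed_convex_def)
  define \<nu>\<^sub>0 where "\<nu>\<^sub>0 = (1 / lam) *\<^sub>R (p + w)"
  have conj_ge: "ereal (- inner \<nu> p - c) \<le> conjugate h (- \<nu>)" for \<nu>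
    unfolding conjugate_def using c by (intro SUP_upper2[of p]) auto
  have "conjugate h (- \<nu>\<^sub>0) \<le> ereal (- inner \<nu>\<^sub>0 p - c)"
    unfolding conjugate_def
  proof (rule SUP_least)
    fix y
    have "inner \<nu>\<^sub>0 (y - p) = inner (p + w) (y - p) / lam"
      by (simp add: \<nu>\<^sub>0_def)
    then have "ereal (c - inner \<nu>\<^sub>0 (y - p)) \<le> h y"
      using prox_subgradient[OF h lam p c, of y] by simp
    then show "ereal (inner (- \<nu>\<^sub>0) y) - h y \<le> ereal (- inner \<nu>\<^sub>0 p - c)"
      by (cases "h y") (auto simp: inner_diff_right)
  qed
  then have conj_eq: "conjugate h (- \<nu>\<^sub>0) = ereal (- inner \<nu>\<^sub>0 p - c)"
    using conj_ge by (rule antisym)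
  \<comment> \<open>This identifies \<open>p\<close> as the gradient of the dual quadratic term at
    \<open>\<nu>\<^sub>0\<close>, which is what makes the linear terms cancel below.\<close>
  have p_eq: "p = lam *\<^sub>R (\<nu>\<^sub>0 - (1 / lam) *\<^sub>R w)"
    using lam by (simp add: \<nu>\<^sub>0_def algebra_simps)
  show ?thesis
    unfolding \<nu>\<^sub>0_def[symmetric]
  proof (rule arg_min_set_quadratic_growth)
    show "conjugate h (- \<nu>\<^sub>0) + ereal (lam / 2 * (norm (\<nu>\<^sub>0 - (1 / lam) *\<^sub>R w))\<^sup>2)
        = ereal ((- inner \<nu>\<^sub>0 p - c) + lam / 2 * (norm (\<nu>\<^sub>0 - (1 / lam) *\<^sub>R w))\<^sup>2)"
      by (simp add: conj_eq)
    show "lam / 2 > 0"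
      using lam by simp
    fix \<nu>
    let ?a = "(1 / lam) *\<^sub>R w"
    have "(norm (\<nu> - ?a))\<^sup>2
        = (norm (\<nu>\<^sub>0 - ?a))\<^sup>2 + 2 * inner (\<nu>\<^sub>0 - ?a) (\<nu> - \<nu>\<^sub>0) + (norm (\<nu> - \<nu>\<^sub>0))\<^sup>2"
      unfolding power2_norm_eq_inner
      by (simp only: inner_diff_left inner_diff_right inner_commute) (simp add: inner_commute)
    then have "lam / 2 * (norm (\<nu> - ?a))\<^sup>2 = lam / 2 * (norm (\<nu>\<^sub>0 - ?a))\<^sup>2
        + lam * inner (\<nu>\<^sub>0 - ?a) (\<nu> - \<nu>\<^sub>0) + lam / 2 * (norm (\<nu> - \<nu>\<^sub>0))\<^sup>2"
      by (simp only: distrib_left)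
    moreover have "lam * inner (\<nu>\<^sub>0 - ?a) (\<nu> - \<nu>\<^sub>0) = inner p (\<nu> - \<nu>\<^sub>0)"
      by (subst p_eq) simp
    moreover have "inner p (\<nu> - \<nu>\<^sub>0) = inner \<nu> p - inner \<nu>\<^sub>0 p"
      by (simp add: inner_diff_right inner_commute)
    ultimately have "(- inner \<nu>\<^sub>0 p - c) + lam / 2 * (norm (\<nu>\<^sub>0 - ?a))\<^sup>2 + lam / 2 * (norm (\<nu> - \<nu>\<^sub>0))\<^sup>2
        = (- inner \<nu> p - c) + lam / 2 * (norm (\<nu> - ?a))\<^sup>2"
      by linarith
    then show "ereal ((- inner \<nu>\<^sub>0 p - c) + lam / 2 * (norm (\<nu>\<^sub>0 - ?a))\<^sup>2
          + lam / 2 * (norm (\<nu> - \<nu>\<^sub>0))\<^sup>2)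
        \<le> conjugate h (- \<nu>) + ereal (lam / 2 * (norm (\<nu> - ?a))\<^sup>2)"
      using add_right_mono[OF conj_ge[of \<nu>]] by (metis plus_ereal.simps(1))
  qed
qed

text \<open>Passing back from the dual to the primal side avoids biconjugation. Once some primal
  proximal point \<open>p'\<close> exists, the two argmin sets are \<open>{p'}\<close> and
  \<open>{(1 / lam) *\<^sub>R (p' + w)}\<close>, so both sides of the equivalence say
  \<open>p = p'\<close>.\<close>

lemma prox_iff_prox_conjugate:
  fixes h :: "'a::{real_inner, complete_space} \<Rightarrow> ereal"
  assumes h: "proper_closed_convex h" and lam: "lam > 0"
    and minorant: "\<exists>\<beta> a. \<forall>x. ereal (\<beta> + inner a x) \<le> h x"
  shows "arg_min_set (\<lambda>x. h x + ereal (1 / (2 * lam) * (norm (x + w))\<^sup>2)) UNIV = {p} \<longleftrightarrow>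
    arg_min_set (\<lambda>\<nu>. conjugate h (- \<nu>) + ereal (lam / 2 * (norm (\<nu> - (1 / lam) *\<^sub>R w))\<^sup>2)) UNIV
      = {(1 / lam) *\<^sub>R (p + w)}"
proof -
  obtain \<beta> a where "\<And>x. ereal (\<beta> + inner a x) \<le> h x"
    using minorant by blast
  from prox_exists[OF h lam this, of w]
  obtain p' where p': "p' \<in> arg_min_set (\<lambda>x. h x + ereal (1 / (2 * lam) * (norm (x + w))\<^sup>2)) UNIV"
    by blast
  show ?thesis
    unfolding prox_unique[OF h lam p'] prox_conjugate[OF h lam p'] using lam by auto
qed

text \<open>Minimality of the Lagrangian in \<open>(s, t)\<close>, with one of the two variables
  frozen at its saddle value, is an affine lower bound of slope \<open>- z\<close> on the other
  function.\<close>

lemma saddle_point_P2_minorant: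
  fixes F G :: "'g::real_inner \<Rightarrow> ereal"
  assumes "proper_fun F" "proper_fun G" "saddle_point (lagrangian_P2 F G) p z"
  shows "\<exists>\<beta> a. \<forall>x. ereal (\<beta> + inner a x) \<le> F x" "\<exists>\<beta> a. \<forall>x. ereal (\<beta> + inner a x) \<le> G x"
proof -
  obtain s t where p: "p = (s, t)"
    by force
  have le: "F s + G t + ereal (inner z (s + t)) \<le> F x + G y + ereal (inner z (x + y))" for x y
    using assms(3) by (auto simp: saddle_point_def lagrangian_P2_def p)
  obtain x0 y0 where "F x0 \<noteq> \<infinity>" "G y0 \<noteq> \<infinity>"
    using assms by (auto simp: proper_fun_def)
  moreover have nm: "F x \<noteq> -\<infinity>" "G x \<noteq> -\<infinity>" for x
    using assms by (auto simp: proper_fun_def)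
  ultimately have "F s \<noteq> \<infinity>" "G t \<noteq> \<infinity>"
    using le[of x0 y0] by auto
  with nm obtain c d where c: "F s = ereal c" and d: "G t = ereal d"
    by (metis ereal_cases)
  have "ereal (c + inner z s + inner (- z) x) \<le> F x" for x
    using le[of x t] nm(1)[of x] by (cases "F x") (auto simp: c d inner_add_right)
  then show "\<exists>\<beta> a. \<forall>x. ereal (\<beta> + inner a x) \<le> F x"
    by blast
  have "ereal (d + inner z t + inner (- z) x) \<le> G x" for x
    using le[of s x] nm(2)[of x] by (cases "G x") (auto simp: c d inner_add_right)
  then show "\<exists>\<beta> a. \<forall>x. ereal (\<beta> + inner a x) \<le> G x"
    by blast
qed

subsection \<open>Minimizing out the fibres\<close>

lemma value_fun_le: "value_fun M h (M x) \<le> h x"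
  by (auto simp: value_fun_def intro: INF_lower)

lemma value_fun_attainedE:
  assumes "proper_fun (value_fun M h)" "value_attained M h" "value_fun M h \<tau> \<noteq> \<infinity>"
  obtains x where "M x = \<tau>" "h x = value_fun M h \<tau>"
proof -
  have "\<bar>value_fun M h \<tau>\<bar> \<noteq> \<infinity>"
    using assms(1,3) by (auto simp: proper_fun_def)
  then show ?thesis
    using assms(2) that unfolding value_attained_def by metis
qed

text \<open>A competitor \<open>\<tau>\<close> of finite value is lifted to a point of its fibre
  that attains the value, and there the minimality of \<open>x\<close> applies. \<open>M\<close>
  stands for \<open>A\<close> as well as for the affine map of the \<open>y\<close>-step.\<close>

lemma arg_min_value_fun_image:
  assumes pr: "proper_fun (value_fun M h)" and att: "value_attained M h"
    and x: "x \<in> arg_min_set (\<lambda>x. h x + ereal (q (M x))) UNIV"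
  shows "M x \<in> arg_min_set (\<lambda>\<tau>. value_fun M h \<tau> + ereal (q \<tau>)) UNIV"
proof -
  have "value_fun M h (M x) + ereal (q (M x)) \<le> value_fun M h \<tau> + ereal (q \<tau>)" for \<tau>
  proof (cases "value_fun M h \<tau> = \<infinity>")
    case False
    then obtain x' where x': "M x' = \<tau>" "h x' = value_fun M h \<tau>"
      using value_fun_attainedE[OF pr att] by metis
    have "value_fun M h (M x) + ereal (q (M x)) \<le> h x + ereal (q (M x))"
      by (intro add_right_mono value_fun_le)
    also have "\<dots> \<le> h x' + ereal (q (M x'))"
      using x by (auto simp: arg_min_set_iff)
    finally show ?thesis
      by (simp add: x')
  qed auto
  then show ?thesis
    by (auto simp: arg_min_set_iff)
qed

text \<open>The reverse passage: \<open>x\<close> attains the value function at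
  \<open>\<tau>\<close>, while at any competitor the value function lies below
  \<open>h\<close>.\<close>

lemma arg_min_value_fun_fibre:
  assumes \<tau>: "\<tau> \<in> arg_min_set (\<lambda>\<tau>. value_fun M h \<tau> + ereal (q \<tau>)) UNIV"
    and x: "x \<in> arg_min_set h {x. M x = \<tau>}"
  shows "x \<in> arg_min_set (\<lambda>x. h x + ereal (q (M x))) UNIV"
proof -
  have Mx: "M x = \<tau>" and hx: "h x = value_fun M h \<tau>"
    using x arg_min_set_inf[OF x] by (auto simp: arg_min_set_iff value_fun_def)
  have "h x + ereal (q (M x)) \<le> h x' + ereal (q (M x'))" for x'
  proof -
    have "h x + ereal (q (M x)) \<le> value_fun M h (M x') + ereal (q (M x'))"
      using \<tau> by (auto simp: arg_min_set_iff hx Mx)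
    also have "\<dots> \<le> h x' + ereal (q (M x'))"
      by (intro add_right_mono value_fun_le)
    finally show ?thesis .
  qed
  then show ?thesis
    by (auto simp: arg_min_set_iff)
qed

text \<open>A proximal point has finite value, and finite values are attained. This shows that the
  choices of \<open>x\<close> and \<open>y\<close> made in recovering Algorithm 1 are
  possible.\<close>

lemma arg_min_fibre_nonempty:
  assumes pr: "proper_fun (value_fun M h)" and att: "value_attained M h"
    and \<tau>: "\<tau> \<in> arg_min_set (\<lambda>\<tau>. value_fun M h \<tau> + ereal (q \<tau>)) UNIV"
  shows "arg_min_set h {x. M x = \<tau>} \<noteq> {}"
proof -
  obtain c where "value_fun M h \<tau> = ereal c"
    using arg_min_set_add_real[OF pr \<tau>] .
  then obtain x where "M x = \<tau>" "h x = value_fun M h \<tau>"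
    using value_fun_attainedE[OF pr att, of \<tau>] by auto
  moreover have "value_fun M h \<tau> \<le> h x'" if "M x' = \<tau>" for x'
    using value_fun_le[of M h x'] that by simp
  ultimately have "x \<in> arg_min_set h {x. M x = \<tau>}"
    by (simp add: arg_min_set_iff)
  then show ?thesis
    by blast
qed

subsection \<open>The three algorithms\<close>

lemma adm_P2_step:
  assumes "adm_P2 F G lam s0 z0 s t z"
  shows "arg_min_set (\<lambda>\<tau>. G \<tau> + ereal (1 / (2 * lam) * (norm (s k + \<tau> + lam *\<^sub>R z k))\<^sup>2)) UNIV
      = {t (Suc k)}"
    and "arg_min_set
      (\<lambda>\<sigma>. F \<sigma> + ereal (1 / (2 * lam) * (norm (\<sigma> + t (Suc k) + lam *\<^sub>R z k))\<^sup>2)) UNIV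
      = {s (Suc k)}"
    and "z (Suc k) = z k + (1 / lam) *\<^sub>R (s (Suc k) + t (Suc k))"
  using assms by (simp_all add: adm_P2_def)

lemma adm_D_step:
  assumes "adm_D F G lam u0 z0 u v z"
  shows "arg_min_set
      (\<lambda>\<nu>. conjugate G (- \<nu>) + ereal (lam / 2 * (norm (u k - \<nu> + (1 / lam) *\<^sub>R z k))\<^sup>2)) UNIV
      = {v (Suc k)}"
    and "arg_min_set
      (\<lambda>\<mu>. conjugate F (- \<mu>) + ereal (lam / 2 * (norm (\<mu> - v (Suc k) + (1 / lam) *\<^sub>R z k))\<^sup>2)) UNIV
      = {u (Suc k)}"
    and "z (Suc k) = z k + lam *\<^sub>R (u (Suc k) - v (Suc k))"
  using assms by (simp_all add: adm_D_def)

text \<open>\<open>t\<close> is compared one index later than \<open>s\<close> and \<open>z\<close>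
  because \<open>t 0\<close> is unconstrained and \<open>t (Suc k)\<close> is determined by
  \<open>s k\<close> and \<open>z k\<close>. This pairing is also what the induction carries
  along.\<close>

lemma adm_P2_unique:
  assumes adm: "adm_P2 F G lam s0 z0 s t z" and adm': "adm_P2 F G lam s0 z0 s' t' z'"
  shows "s k = s' k \<and> z k = z' k \<and> t (Suc k) = t' (Suc k)"
proof -
  have t: "t (Suc k) = t' (Suc k)" if "s k = s' k" "z k = z' k" for k
    using adm_P2_step(1)[OF adm, of k] adm_P2_step(1)[OF adm', of k] unfolding that by simp
  have s: "s (Suc k) = s' (Suc k)" if "t (Suc k) = t' (Suc k)" "z k = z' k" for k
    using adm_P2_step(2)[OF adm, of k] adm_P2_step(2)[OF adm', of k] unfolding that by simp
  show ?thesis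
  proof (induction k)
    case 0
    have "s 0 = s' 0" "z 0 = z' 0"
      using adm adm' by (simp_all add: adm_P2_def)
    with t show ?case
      by simp
  next
    case (Suc k)
    then have "s (Suc k) = s' (Suc k)"
      using s by simp
    moreover have "z (Suc k) = z' (Suc k)"
      using Suc \<open>s (Suc k) = s' (Suc k)\<close>
      unfolding adm_P2_step(3)[OF adm] adm_P2_step(3)[OF adm'] by simp
    ultimately show ?case
      using t by simp
  qed
qed

lemma adm_D_unique:
  assumes adm: "adm_D F G lam u0 z0 u v z" and adm': "adm_D F G lam u0 z0 u' v' z'"
  shows "u k = u' k \<and> z k = z' k"
proof (induction k)
  case 0
  then show ?case
    using assms by (simp add: adm_D_def)
next
  case (Suc k)
  then have eq: "u k = u' k" "z k = z' k"
    by auto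
  have v: "v (Suc k) = v' (Suc k)"
    using adm_D_step(1)[OF adm, of k] adm_D_step(1)[OF adm', of k] unfolding eq by simp
  have "u (Suc k) = u' (Suc k)"
    using adm_D_step(2)[OF adm, of k] adm_D_step(2)[OF adm', of k] unfolding eq v by simp
  then show ?case
    unfolding adm_D_step(3)[OF adm] adm_D_step(3)[OF adm'] eq v by simp
qed

text \<open>Each subproblem of Algorithm 1 depends on its variable through \<open>h\<close> and a
  quadratic in its image. The image of any chosen minimizer is therefore a proximal point, and
  uniqueness of proximal points gives the singletons that \<open>adm_P2\<close> demands.\<close>

lemma adm_P2_of_P1:
  assumes F: "F = value_fun A f" "proper_closed_convex F" "value_attained A f"
    and G: "G = value_fun (\<lambda>y. B y - b) g" "proper_closed_convex G"
      "value_attained (\<lambda>y. B y - b) g"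
    and lam: "lam > 0"
    and adm: "adm_P1 f g A B b lam x0 z0 x y z"
  shows "adm_P2 F G lam (A x0) z0 (\<lambda>k. A (x k)) (\<lambda>k. B (y k) - b) z"
  unfolding adm_P2_def
proof (intro conjI allI)
  fix k
  have prF: "proper_fun (value_fun A f)" and prG: "proper_fun (value_fun (\<lambda>y. B y - b) g)"
    using F G by (auto simp: proper_closed_convex_def)
  let ?q = "\<lambda>\<tau>. 1 / (2 * lam) * (norm (\<tau> + (A (x k) + lam *\<^sub>R z k)))\<^sup>2"
  have "y (Suc k) \<in> arg_min_set (\<lambda>\<eta>. g \<eta> + ereal (?q (B \<eta> - b))) UNIV"
    using adm by (simp add: adm_P1_def algebra_simps)
  from arg_min_value_fun_image[OF prG G(3) this]
  have "arg_min_set (\<lambda>\<tau>. G \<tau> + ereal (?q \<tau>)) UNIV = {B (y (Suc k)) - b}"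
    unfolding G(1)[symmetric] by (rule prox_unique[OF G(2) lam])
  then show "arg_min_set (\<lambda>\<tau>. G \<tau> + ereal (1 / (2 * lam) * (norm (A (x k) + \<tau> + lam *\<^sub>R z k))\<^sup>2)) UNIV
      = {B (y (Suc k)) - b}"
    by (simp add: algebra_simps)
  let ?r = "\<lambda>\<sigma>. 1 / (2 * lam) * (norm (\<sigma> + (B (y (Suc k)) - b + lam *\<^sub>R z k)))\<^sup>2"
  have "x (Suc k) \<in> arg_min_set (\<lambda>\<xi>. f \<xi> + ereal (?r (A \<xi>))) UNIV"
    using adm by (simp add: adm_P1_def algebra_simps)
  from arg_min_value_fun_image[OF prF F(3) this]
  have "arg_min_set (\<lambda>\<sigma>. F \<sigma> + ereal (?r \<sigma>)) UNIV = {A (x (Suc k))}"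
    unfolding F(1)[symmetric] by (rule prox_unique[OF F(2) lam])
  then show "arg_min_set (\<lambda>\<sigma>. F \<sigma> + ereal (1 / (2 * lam) *
      (norm (\<sigma> + (B (y (Suc k)) - b) + lam *\<^sub>R z k))\<^sup>2)) UNIV = {A (x (Suc k))}"
    by (simp add: algebra_simps)
qed (use adm in \<open>auto simp: adm_P1_def algebra_simps\<close>)

lemma adm_P2_arg_min:
  assumes "adm_P2 F G lam s0 z0 s t z"
  shows "t (Suc k) \<in> arg_min_set
      (\<lambda>\<tau>. G \<tau> + ereal (1 / (2 * lam) * (norm (s k + \<tau> + lam *\<^sub>R z k))\<^sup>2)) UNIV"
    and "s (Suc k) \<in> arg_min_set
      (\<lambda>\<sigma>. F \<sigma> + ereal (1 / (2 * lam) * (norm (\<sigma> + t (Suc k) + lam *\<^sub>R z k))\<^sup>2)) UNIV"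
  by (simp_all only: adm_P2_step[OF assms] singleton_iff)

lemma adm_P2_fibres_nonempty:
  assumes "proper_fun (value_fun A f)" "value_attained A f"
    and "proper_fun (value_fun M g)" "value_attained M g"
    and "adm_P2 (value_fun A f) (value_fun M g) lam s0 z0 s t z"
  shows "arg_min_set g {y. M y = t (Suc k)} \<noteq> {}" "arg_min_set f {x. A x = s (Suc k)} \<noteq> {}"
  using arg_min_fibre_nonempty[OF assms(3,4) adm_P2_arg_min(1)[OF assms(5)]]
    arg_min_fibre_nonempty[OF assms(1,2) adm_P2_arg_min(2)[OF assms(5)]] by auto

lemma adm_P1_of_P2:
  assumes adm: "adm_P2 (value_fun A f) (value_fun (\<lambda>y. B y - b) g) lam (A x0) z0 s t z"
    and init: "x 0 = x0" "z 0 = z0"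
    and y: "\<And>k. y (Suc k) \<in> arg_min_set g {y. B y - b = t (Suc k)}"
    and x: "\<And>k. x (Suc k) \<in> arg_min_set f {x. A x = s (Suc k)}"
  shows "adm_P1 f g A B b lam x0 z0 x y z"
  unfolding adm_P1_def
proof (intro conjI allI)
  fix k
  \<comment> \<open>Index 0 rests on the initial values, later indices on membership in the fibre;
    the \<open>y\<close>-step at \<open>k = 0\<close> needs the former.\<close>
  have A: "A (x j) = s j" for j
    using adm init x[of "j - 1"] by (cases j) (auto simp: adm_P2_def arg_min_set_iff)
  have B: "B (y (Suc k)) - b = t (Suc k)"
    using y[of k] by (auto simp: arg_min_set_iff)
  show "y (Suc k) \<in> arg_min_set
      (\<lambda>\<eta>. g \<eta> + ereal (1 / (2 * lam) * (norm (A (x k) + B \<eta> - b + lam *\<^sub>R z k))\<^sup>2)) UNIV"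
    using arg_min_value_fun_fibre[OF adm_P2_arg_min(1)[OF adm] y[of k]] by (simp add: A add_diff_eq)
  show "x (Suc k) \<in> arg_min_set
      (\<lambda>\<xi>. f \<xi> + ereal (1 / (2 * lam) * (norm (A \<xi> + B (y (Suc k)) - b + lam *\<^sub>R z k))\<^sup>2)) UNIV"
    using arg_min_value_fun_fibre[OF adm_P2_arg_min(2)[OF adm] x[of k]]
    by (simp add: B[symmetric] add_diff_eq)
  show "z (Suc k) = z k + (1 / lam) *\<^sub>R (A (x (Suc k)) + B (y (Suc k)) - b)"
    using adm by (simp add: adm_P2_def A B[symmetric] add_diff_eq)
qed (rule init)+

text \<open>Primal iterate and multiplier exchange roles: \<open>z\<close> is the
  \<open>u\<close>-sequence of Algorithm 3 and \<open>s\<close> its multiplier. The hypothesis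
  \<open>vt\<close> is the Moreau correspondence for the first step, with shift
  \<open>s k + lam *\<^sub>R z k\<close>.\<close>

lemma adm_P2_iff_adm_D:
  fixes F G :: "'g::{real_inner, complete_space} \<Rightarrow> ereal"
  assumes F: "proper_closed_convex F" "\<exists>\<beta> a. \<forall>x. ereal (\<beta> + inner a x) \<le> F x"
    and G: "proper_closed_convex G" "\<exists>\<beta> a. \<forall>x. ereal (\<beta> + inner a x) \<le> G x"
    and lam: "lam > 0"
    and vt: "\<And>k. v (Suc k) = (1 / lam) *\<^sub>R (t (Suc k) + (s k + lam *\<^sub>R z k))"
  shows "adm_P2 F G lam s0 z0 s t z \<longleftrightarrow> adm_D F G lam z0 s0 z v s"
proof -
  have first: "arg_min_set
         (\<lambda>\<tau>. G \<tau> + ereal (1 / (2 * lam) * (norm (s k + \<tau> + lam *\<^sub>R z k))\<^sup>2)) UNIV = {t (Suc k)}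
     \<longleftrightarrow> arg_min_set
         (\<lambda>\<nu>. conjugate G (- \<nu>) + ereal (lam / 2 * (norm (z k - \<nu> + (1 / lam) *\<^sub>R s k))\<^sup>2)) UNIV
         = {v (Suc k)}" for k
  proof -
    have "norm (z k - \<nu> + (1 / lam) *\<^sub>R s k) = norm (\<nu> - (1 / lam) *\<^sub>R (s k + lam *\<^sub>R z k))" for \<nu>
      using lam by (subst norm_minus_commute) (simp add: algebra_simps)
    moreover have "s k + \<tau> + lam *\<^sub>R z k = \<tau> + (s k + lam *\<^sub>R z k)" for \<tau>
      by simp
    ultimately show ?thesis
      using prox_iff_prox_conjugate[OF G(1) lam G(2)] by (simp only: vt)
  qed
  \<comment> \<open>Both multiplier updates are brought to the same identity, which is the Moreau
    correspondence between \<open>s (Suc k)\<close> and \<open>z (Suc k)\<close> for the second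
    step, with shift \<open>t (Suc k) + lam *\<^sub>R z k\<close>.\<close>
  have upd: "z (Suc k) = z k + (1 / lam) *\<^sub>R (s (Suc k) + t (Suc k))
      \<longleftrightarrow> z (Suc k) = (1 / lam) *\<^sub>R (s (Suc k) + (t (Suc k) + lam *\<^sub>R z k))" for k
    using lam by (simp add: algebra_simps)
  have upd': "s (Suc k) = s k + lam *\<^sub>R (z (Suc k) - v (Suc k))
      \<longleftrightarrow> z (Suc k) = (1 / lam) *\<^sub>R (s (Suc k) + (t (Suc k) + lam *\<^sub>R z k))" for k
  proof -
    have "s k + lam *\<^sub>R (z (Suc k) - v (Suc k)) = lam *\<^sub>R z (Suc k) - (t (Suc k) + lam *\<^sub>R z k)"
      using lam by (simp add: vt algebra_simps)
    then have "s (Suc k) = s k + lam *\<^sub>R (z (Suc k) - v (Suc k))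
        \<longleftrightarrow> lam *\<^sub>R z (Suc k) = s (Suc k) + (t (Suc k) + lam *\<^sub>R z k)"
      by (auto simp: eq_diff_eq)
    also have "\<dots> \<longleftrightarrow> z (Suc k) = (1 / lam) *\<^sub>R (s (Suc k) + (t (Suc k) + lam *\<^sub>R z k))"
      using divideR_right[of lam "z (Suc k)"] lam by (simp add: inverse_eq_divide)
    finally show ?thesis .
  qed
  \<comment> \<open>The second steps match only when \<open>z (Suc k)\<close> is the dual point
    belonging to \<open>s (Suc k)\<close>. This premise is available on either side, being the
    common form of the updates.\<close>
  have second: "arg_min_set
         (\<lambda>\<sigma>. F \<sigma> + ereal (1 / (2 * lam) * (norm (\<sigma> + t (Suc k) + lam *\<^sub>R z k))\<^sup>2)) UNIV
         = {s (Suc k)}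
     \<longleftrightarrow> arg_min_set
         (\<lambda>\<mu>. conjugate F (- \<mu>) + ereal (lam / 2 * (norm (\<mu> - v (Suc k) + (1 / lam) *\<^sub>R s k))\<^sup>2)) UNIV
         = {z (Suc k)}"
    if "z (Suc k) = (1 / lam) *\<^sub>R (s (Suc k) + (t (Suc k) + lam *\<^sub>R z k))" for k
  proof -
    have "\<mu> - v (Suc k) + (1 / lam) *\<^sub>R s k = \<mu> - (1 / lam) *\<^sub>R (t (Suc k) + lam *\<^sub>R z k)" for \<mu>
      using lam by (simp add: vt algebra_simps)
    then show ?thesis
      using prox_iff_prox_conjugate[OF F(1) lam F(2)] by (simp only: that add.assoc)
  qed
  show ?thesis
    unfolding adm_P2_def adm_D_def first upd upd' using second by blast
qed

theorem theorem1:
  fixes A :: "'a::{real_inner, complete_space} \<Rightarrow> 'g::{real_inner, complete_space}"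
    and B :: "'b::{real_inner, complete_space} \<Rightarrow> 'g"
    and b :: 'g
    and f :: "'a \<Rightarrow> ereal"
    and g :: "'b \<Rightarrow> ereal"
    and F G :: "'g \<Rightarrow> ereal"
    and lam :: real
    and x10 :: 'a
    and z10 s20 z20 u30 z30 :: 'g
  assumes "bounded_linear A" and "bounded_linear B"
    and "proper_closed_convex f" and "proper_closed_convex g"
    and "F = value_fun A f" and "G = value_fun (\<lambda>y. B y - b) g"
    and "proper_closed_convex F" and "proper_closed_convex G"
    and "value_attained A f" and "value_attained (\<lambda>y. B y - b) g"
    and "\<exists>p z. saddle_point (lagrangian_P1 f g A B b) p z"
    and "\<exists>p z. saddle_point (lagrangian_P2 F G) p z"
    and "\<exists>p z. saddle_point (lagrangian_D F G) p z"
    and "lam > 0"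
    and "A x10 = s20" and "s20 = z30"
    and "z10 = z20" and "z20 = u30"
  shows
    "(\<forall>x y z. adm_P1 f g A B b lam x10 z10 x y z \<longrightarrow>
        adm_P2 F G lam s20 z20 (\<lambda>k. A (x k)) (\<lambda>k. B (y k) - b) z \<and>
        (\<forall>s t z2. adm_P2 F G lam s20 z20 s t z2 \<longrightarrow>
           (\<forall>k\<ge>1. t k = B (y k) - b \<and> s k = A (x k) \<and> z2 k = z k)))
     \<and>
     (\<forall>s t z2. adm_P2 F G lam s20 z20 s t z2 \<longrightarrow>
        (\<forall>k\<ge>1. arg_min_set g {y. B y - b = t k} \<noteq> {} \<and> arg_min_set f {x. A x = s k} \<noteq> {}) \<and>
        (\<forall>x y z. x 0 = x10 \<and> z 0 = z10 \<and>
           (\<forall>k\<ge>1. y k \<in> arg_min_set g {y. B y - b = t k} \<and>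
                  x k \<in> arg_min_set f {x. A x = s k} \<and>
                  z k = z2 k) \<longrightarrow>
           adm_P1 f g A B b lam x10 z10 x y z))
     \<and>
     (\<forall>s t z2. adm_P2 F G lam s20 z20 s t z2 \<longrightarrow>
        (\<exists>v. adm_D F G lam u30 z30 z2 v s))
     \<and>
     (\<forall>u v z3. adm_D F G lam u30 z30 u v z3 \<longrightarrow>
        (\<exists>t. adm_P2 F G lam s20 z20 z3 t u))
     \<and>
     (\<forall>s t z2 u v z3.
        adm_P2 F G lam s20 z20 s t z2 \<and> adm_D F G lam u30 z30 u v z3 \<longrightarrow>
        (\<forall>k. u k = z2 k \<and> z3 k = s k))"
proof -
  note F = \<open>F = value_fun A f\<close> \<open>proper_closed_convex F\<close> \<open>value_attained A f\<close>
  note G = \<open>G = value_fun (\<lambda>y. B y - b) g\<close> \<open>proper_closed_convex G\<close>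
    \<open>value_attained (\<lambda>y. B y - b) g\<close>
  note lam = \<open>lam > 0\<close>
  have s20: "s20 = A x10" and z30: "z30 = A x10" and z20: "z20 = z10" and u30: "u30 = z10"
    using assms by auto
  have prF: "proper_fun F" and prG: "proper_fun G"
    using F G by (auto simp: proper_closed_convex_def)
  obtain p \<zeta> where "saddle_point (lagrangian_P2 F G) p \<zeta>"
    using \<open>\<exists>p z. saddle_point (lagrangian_P2 F G) p z\<close> by blast
  note minorants = saddle_point_P2_minorant[OF prF prG this]
  note iff = adm_P2_iff_adm_D[OF F(2) minorants(1) G(2) minorants(2) lam]
  have P1_P2: "adm_P2 F G lam s20 z20 (\<lambda>k. A (x k)) (\<lambda>k. B (y k) - b) z"
    if "adm_P1 f g A B b lam x10 z10 x y z" for x y z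
    unfolding s20 z20 using adm_P2_of_P1[OF F G lam that] .
  have unique: "t k = B (y k) - b \<and> s k = A (x k) \<and> z2 k = z k"
    if "adm_P1 f g A B b lam x10 z10 x y z" "adm_P2 F G lam s20 z20 s t z2" "k \<ge> 1"
    for x y z s t z2 k
    \<comment> \<open>The instance at \<open>k\<close> settles \<open>s\<close> and
      \<open>z2\<close>; the one at \<open>k - 1\<close> settles \<open>t k\<close>, which is where
      \<open>k \<ge> 1\<close> enters.\<close>
    using adm_P2_unique[OF that(2) P1_P2[OF that(1)], of k]
      adm_P2_unique[OF that(2) P1_P2[OF that(1)], of "k - 1"] \<open>k \<ge> 1\<close> by simp
  have nonempty: "arg_min_set g {y. B y - b = t k} \<noteq> {} \<and> arg_min_set f {x. A x = s k} \<noteq> {}"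
    if "adm_P2 F G lam s20 z20 s t z2" "k \<ge> 1" for s t z2 k
    using adm_P2_fibres_nonempty[OF prF[unfolded F(1)] F(3) prG[unfolded G(1)] G(3)
        that(1)[unfolded F(1) G(1)], of "k - 1"] \<open>k \<ge> 1\<close> by simp
  have P2_P1: "adm_P1 f g A B b lam x10 z10 x y z"
    if adm: "adm_P2 F G lam s20 z20 s t z2" and "x 0 = x10" "z 0 = z10"
      and xyz: "\<forall>k\<ge>1. y k \<in> arg_min_set g {y. B y - b = t k} \<and>
        x k \<in> arg_min_set f {x. A x = s k} \<and> z k = z2 k" for s t z2 x y z
  proof -
    \<comment> \<open>Agreement is assumed only from index 1 on; the common initial value extends it
      to equality of the sequences.\<close>
    have "z2 0 = z 0"
      using adm \<open>z 0 = z10\<close> by (simp add: adm_P2_def z20)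
    then have "z2 k = z k" for k
      using xyz by (cases k) auto
    then have "z2 = z"
      by blast
    then have "adm_P2 (value_fun A f) (value_fun (\<lambda>y. B y - b) g) lam (A x10) z10 s t z"
      using adm by (simp add: s20 z20 F(1) G(1))
    then show ?thesis
      using \<open>x 0 = x10\<close> \<open>z 0 = z10\<close>
    proof (rule adm_P1_of_P2)
      fix k
      show "y (Suc k) \<in> arg_min_set g {y. B y - b = t (Suc k)}"
        and "x (Suc k) \<in> arg_min_set f {x. A x = s (Suc k)}"
        using xyz[rule_format, of "Suc k"] by simp_all
    qed
  qed
  have P2_D: "\<exists>v. adm_D F G lam u30 z30 z2 v s" if "adm_P2 F G lam s20 z20 s t z2" for s t z2
    \<comment> \<open>The witness is the formula \<open>vt\<close> shifted to index
      \<open>k\<close>. At index 0 the truncated \<open>k - 1\<close> gives a harmless value, since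
      \<open>v 0\<close> is unconstrained.\<close>
    using that iff[of "\<lambda>k. (1 / lam) *\<^sub>R (t k + (s (k - 1) + lam *\<^sub>R z2 (k - 1)))" t s z2]
    by (auto simp: s20 z20 u30 z30)
  have D_P2: "\<exists>t. adm_P2 F G lam s20 z20 z3 t u" if "adm_D F G lam u30 z30 u v z3" for u v z3
    \<comment> \<open>The witness for \<open>t\<close> is \<open>vt\<close> solved for
      \<open>t (Suc k)\<close>, with \<open>z3\<close> in place of \<open>s\<close> and
      \<open>u\<close> in place of \<open>z\<close>; its entry at 0 is again arbitrary.\<close>
    using that lam iff[of v "\<lambda>k. lam *\<^sub>R v k - (z3 (k - 1) + lam *\<^sub>R u (k - 1))" z3 u]
    by (auto simp: s20 z20 u30 z30)
  have coincide: "u k = z2 k \<and> z3 k = s k"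
    if "adm_P2 F G lam s20 z20 s t z2" "adm_D F G lam u30 z30 u v z3" for s t z2 u v z3 k
    \<comment> \<open>The pair \<open>z2\<close>, \<open>s\<close> already comes from a run of
      Algorithm 3 with the same initial data, so it equals \<open>u\<close>, \<open>z3\<close> by
      uniqueness.\<close>
    using P2_D[OF that(1)] adm_D_unique[OF that(2)] by blast
  show ?thesis
  proof (intro conjI allI impI)
    fix x y z assume adm: "adm_P1 f g A B b lam x10 z10 x y z"
    then show "adm_P2 F G lam s20 z20 (\<lambda>k. A (x k)) (\<lambda>k. B (y k) - b) z"
      by (rule P1_P2)
    fix s t z2 and k :: nat assume "adm_P2 F G lam s20 z20 s t z2" "1 \<le> k"
    with adm show "t k = B (y k) - b" "s k = A (x k)" "z2 k = z k"
      by (simp_all add: unique)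
  next
    fix s t z2 assume adm: "adm_P2 F G lam s20 z20 s t z2"
    then show "\<exists>v. adm_D F G lam u30 z30 z2 v s"
      by (rule P2_D)
    show "arg_min_set g {y. B y - b = t k} \<noteq> {}" "arg_min_set f {x. A x = s k} \<noteq> {}"
      if "1 \<le> k" for k
      using nonempty[OF adm that] by simp_all
    fix x y z
    assume "x 0 = x10 \<and> z 0 = z10 \<and> (\<forall>k\<ge>1. y k \<in> arg_min_set g {y. B y - b = t k} \<and>
      x k \<in> arg_min_set f {x. A x = s k} \<and> z k = z2 k)"
    then show "adm_P1 f g A B b lam x10 z10 x y z"
      by (elim conjE) (rule P2_P1[OF adm])
  next
    fix u v z3 assume "adm_D F G lam u30 z30 u v z3"
    then show "\<exists>t. adm_P2 F G lam s20 z20 z3 t u"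
      by (rule D_P2)
  next
    fix s t z2 u v z3 k
    assume "adm_P2 F G lam s20 z20 s t z2 \<and> adm_D F G lam u30 z30 u v z3"
    then have "u k = z2 k \<and> z3 k = s k"
      by (elim conjE) (rule coincide)
    then show "u k = z2 k" "z3 k = s k"
      by simp_all
  qed
qed

end
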